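(* Let $\varepsilon>0$. Then there exists a constant $C=C(\varepsilon)>0$, depending only on $\varepsilon$, such that for every $M\in\mathbb{Z}$, every $N\in\mathbb{N}$ (so $N\ge 1$), every real $Q\ge 1$ and every sequence of complex numbers $(a_n)_{n\in\mathbb{Z}}$, $$ \sum_{q\le Q}\ \sum_{\substack{a=1\\ (a,q)=1}}^{q^2}\left|S\left(\frac{a}{q^2}\right)\right|^2\le C\,(NQ)^{\varepsilon}\left(Q^3+N+\sqrt{N}\,Q^2\right)Z, $$ where $$ S(\alpha):=\sum_{n=M+1}^{M+N}a_n e(n\alpha)\quad(\alpha\in\mathbb{R})\qquad\text{and}\qquad Z:=\sum_{n=M+1}^{M+N}|a_n|^2 . $$
   Context: Here $e(x):=\exp(2\pi i x)$ for real $x$, $(a,q)$ denotes the greatest common divisor of $a$ and $q$, the outer sum runs over positive integers $q\le Q$, and the inner sum runs over integers $a$ with $1\le a\le q^2$ and $(a,q)=1$. *)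

theory Defs
  imports Complex_Main
begin

definition e :: "real \<Rightarrow> complex" where
  "e x = exp (2 * of_real pi * \<i> * of_real x)"

definition S :: "(int \<Rightarrow> complex) \<Rightarrow> int \<Rightarrow> nat \<Rightarrow> real \<Rightarrow> complex" where
  "S a M N \<alpha> = (\<Sum>n = M + 1..M + int N. a n * e (of_int n * \<alpha>))"

definition Z :: "(int \<Rightarrow> complex) \<Rightarrow> int \<Rightarrow> nat \<Rightarrow> real" where
  "Z a M N = (\<Sum>n = M + 1..M + int N. (cmod (a n))\<^sup>2)"

end

theory Submission
  imports Defs "HOL-Analysis.Kronecker_Approximation_Theorem"
begin

text \<open>
  By duality and the positivity of the Fejer kernel, \<open>\<Sum> |S(\<alpha>\<^sub>r)|\<^sup>2\<close> is at most \<open>9 K N Z\<close>, where \<open>K\<close> bounds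
  the number of points \<open>\<alpha>\<^sub>r\<close> modulo 1 in any interval of length \<open>1/N\<close>. It remains to count the
  \<open>a/q\<^sup>2\<close> within \<open>1/N\<close> of a given \<open>\<beta>\<close>.

  Write \<open>\<beta> = b/r + z\<close> with \<open>r \<le> \<surd>N\<close>, \<open>|rz| \<le> 2/\<surd>N\<close> (Dirichlet) and put \<open>m = ar - bq\<^sup>2\<close>, so that
  \<open>m = rq\<^sup>2(z + O(1/N))\<close>. The value \<open>m = 0\<close> forces \<open>q\<^sup>2 = r\<close> and \<open>a = b\<close>. With \<open>y = max |z| (2/N)\<close>,
  there are \<open>O(rQ\<^sup>2y)\<close> other values of \<open>m\<close>; each confines \<open>q\<close> to an interval of length
  \<open>L = 4Q/(Ny)\<close> and to the solutions of \<open>bq\<^sup>2 + m \<equiv> 0\<close> modulo \<open>r\<close>. On average over \<open>m\<close> there are at most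
  \<open>O(\<tau>(r)(1 + L/r))\<close> such \<open>q\<close>, which gives \<open>1 + O(\<tau>(r)(Q\<^sup>2/\<surd>N + Q\<^sup>3/N))\<close> fractions in total.
\<close>

section \<open>The divisor bound\<close>

text \<open>Every divisor of the product splits into a divisor of each factor, and the divisors of
  \<open>p ^ k\<close> are the \<open>k + 1\<close> powers of \<open>p\<close>.\<close>

lemma card_divisors_prime_power_mult_le:
  fixes p k m :: nat
  assumes "prime p" "m > 0"
  shows "card {d. d dvd p ^ k * m} \<le> (k + 1) * card {d. d dvd m}"
proof -
  have "{d. d dvd p ^ k * m} \<subseteq> (\<lambda>(i, d). p ^ i * d) ` ({..k} \<times> {d. d dvd m})"
  proof
    fix d assume "d \<in> {d. d dvd p ^ k * m}"
    then obtain x y where xy: "d = x * y" "x dvd p ^ k" "y dvd m"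
      using division_decomp[of d "p ^ k" m] by auto
    then obtain i where "i \<le> k" "x = p ^ i"
      using divides_primepow_nat[OF assms(1)] by blast
    with xy show "d \<in> (\<lambda>(i, d). p ^ i * d) ` ({..k} \<times> {d. d dvd m})"
      by (intro image_eqI[of _ _ "(i, y)"]) auto
  qed
  moreover have fin: "finite ({..k} \<times> {d. d dvd m})"
    using assms(2) by simp
  ultimately have "card {d. d dvd p ^ k * m} \<le> card ({..k} \<times> {d. d dvd m})"
    by (rule surj_card_le[rotated])
  thus ?thesis by (simp add: card_cartesian_product)
qed

text \<open>Controls the loss at a small prime. It is \<open>1 + x \<le> exp x\<close> with
  \<open>x = k * \<epsilon> * ln 2\<close>.\<close>

lemma Suc_le_two_powr:
  fixes \<epsilon> :: real
  assumes "\<epsilon> > 0"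
  shows "real k + 1 \<le> max 1 (1 / (\<epsilon> * ln 2)) * 2 powr (real k * \<epsilon>)"
proof -
  let ?c = "\<epsilon> * ln 2"
  have c: "?c > 0" using assms by simp
  have "real k + 1 \<le> max 1 (1 / ?c) * (1 + real k * ?c)"
  proof -
    have "real k = 1 / ?c * (real k * ?c)" using assms by simp
    also have "\<dots> \<le> max 1 (1 / ?c) * (real k * ?c)"
      using c by (intro mult_right_mono) auto
    finally show ?thesis
      by (simp add: distrib_left)
  qed
  also have "\<dots> \<le> max 1 (1 / ?c) * exp (real k * ?c)"
    by (intro mult_left_mono exp_ge_add_one_self) auto
  also have "exp (real k * ?c) = 2 powr (real k * \<epsilon>)"
    by (simp add: powr_def mult_ac)
  finally show ?thesis .
qed

text \<open>Induction strips off one prime power \<open>p ^ k\<close> at a time, comparing the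
  factor \<open>k + 1\<close> with \<open>p powr (k * \<epsilon>)\<close>. Only finitely many primes
  lose anything, a factor \<open>B\<close> each.\<close>

lemma divisor_bound:
  fixes \<epsilon> :: real
  assumes "\<epsilon> > 0"
  shows "\<exists>C\<ge>1. \<forall>n>0. real (card {d::nat. d dvd n}) \<le> C * real n powr \<epsilon>"
proof -
  define B where "B = max 1 (1 / (\<epsilon> * ln 2))"
  \<comment> \<open>Threshold chosen so that \<open>p \<ge> P\<close> gives
    \<open>p powr \<epsilon> \<ge> 2\<close>, whence
    \<open>p powr (k * \<epsilon>) \<ge> 2 ^ k \<ge> k + 1\<close> without any constant.\<close>
  define P where "P = 2 powr (1 / \<epsilon>)"
  define small where "small n = {p::nat. prime p \<and> p dvd n \<and> real p < P}" for n
  have B1: "B \<ge> 1" by (simp add: B_def)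
  have fin: "finite {p::nat. real p < P}"
    by (rule finite_subset[of _ "{..nat \<lceil>P\<rceil>}"]) (auto simp: le_nat_iff, linarith)
  have main: "real (card {d. d dvd n}) \<le> B ^ card (small n) * real n powr \<epsilon>" if "n > 0" for n :: nat
    using that
  proof (induction n rule: less_induct)
    case (less n)
    show ?case
    proof (cases "n = 1")
      case True
      then show ?thesis using B1 by (simp add: one_le_power)
    next
      case False
      then obtain p where p: "prime p" "p dvd n"
        using prime_factor_nat by blast
      define k where "k = multiplicity p n"
      obtain m where m: "n = p ^ k * m" "\<not> p dvd m"
        using multiplicity_decompose'[of n p thesis] less.prems prime_gt_1_nat[OF p(1)] that
        unfolding k_def by simp
      have k: "k > 0"
        using p less.prems by (simp add: k_def prime_multiplicity_gt_zero_iff)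
      have m0: "m > 0" using m less.prems by (cases m) auto
      have p2: "p \<ge> 2" using p(1) by (rule prime_ge_2_nat)
      have "p ^ k > 1" using k p2 by (intro one_less_power) auto
      hence "m < n" using m m0 by simp
      have IH: "real (card {d. d dvd m}) \<le> B ^ card (small m) * real m powr \<epsilon>"
        using less.IH[OF \<open>m < n\<close> m0] .
      have subn: "small n \<subseteq> {p::nat. real p < P}" by (auto simp: small_def)
      have fn: "finite (small n)" using subn fin by (rule finite_subset)
      have sm: "small m \<subseteq> small n" using m by (auto simp: small_def)
      have np: "real n powr \<epsilon> = real p powr (real k * \<epsilon>) * real m powr \<epsilon>"
        using m(1) p2 by (simp add: powr_mult powr_realpow[symmetric] powr_powr)
      have key: "(real k + 1) * B ^ card (small m) \<le> B ^ card (small n) * real p powr (real k * \<epsilon>)"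
      proof (cases "real p < P")
        case True
        \<comment> \<open>A small prime \<open>p\<close> is counted by \<open>small n\<close> but
          not by \<open>small m\<close>, which pays for the extra factor \<open>B\<close>.\<close>
        have "insert p (small m) \<subseteq> small n"
          using sm p True by (auto simp: small_def)
        moreover have "p \<notin> small m" using m(2) by (auto simp: small_def)
        ultimately have "Suc (card (small m)) \<le> card (small n)"
          using card_mono[OF fn] fn by (metis card_insert_disjoint finite_subset sm)
        hence "B * B ^ card (small m) \<le> B ^ card (small n)"
          using power_increasing[OF _ B1] by (metis power_Suc)
        moreover have "real k + 1 \<le> B * real p powr (real k * \<epsilon>)"
        proof -
          have "real k + 1 \<le> B * 2 powr (real k * \<epsilon>)"
            unfolding B_def using assms by (rule Suc_le_two_powr)
          also have "\<dots> \<le> B * real p powr (real k * \<epsilon>)"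
            using B1 p2 assms by (intro mult_left_mono powr_mono2) auto
          finally show ?thesis .
        qed
        ultimately show ?thesis
        proof -
          assume a: "B * B ^ card (small m) \<le> B ^ card (small n)"
            and b: "real k + 1 \<le> B * real p powr (real k * \<epsilon>)"
          have "(real k + 1) * B ^ card (small m) \<le> (B * real p powr (real k * \<epsilon>)) * B ^ card (small m)"
            using b B1 by (intro mult_right_mono) auto
          also have "\<dots> = (B * B ^ card (small m)) * real p powr (real k * \<epsilon>)" by simp
          also have "\<dots> \<le> B ^ card (small n) * real p powr (real k * \<epsilon>)"
            using a by (intro mult_right_mono) auto
          finally show ?thesis .
        qed
      next
        case False
        have "real k + 1 \<le> 2 ^ k"
          by (metis add.commute of_nat_Suc of_nat_le_iff of_nat_numeral of_nat_power plus_1_eq_Suc Suc_leI less_exp)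
        also have "\<dots> = (2::real) powr (real k)" by (simp add: powr_realpow)
        also have "\<dots> = P powr (real k * \<epsilon>)"
          using assms by (simp add: P_def powr_powr)
        also have "\<dots> \<le> real p powr (real k * \<epsilon>)"
          using False assms by (intro powr_mono2) (auto simp: P_def)
        finally have "real k + 1 \<le> real p powr (real k * \<epsilon>)" .
        moreover have "B ^ card (small m) \<le> B ^ card (small n)"
          using card_mono[OF fn sm] B1 by (rule power_increasing)
        ultimately show ?thesis
          using B1 by (subst mult.commute, intro mult_mono) auto
      qed
      have "real (card {d. d dvd n}) \<le> (real k + 1) * real (card {d. d dvd m})"
        using of_nat_mono[OF card_divisors_prime_power_mult_le[OF p(1) m0, of k], where ?'a = real]
        unfolding m(1)[symmetric] by (simp add: algebra_simps)
      also have "\<dots> \<le> (real k + 1) * (B ^ card (small m) * real m powr \<epsilon>)"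
        using IH by (intro mult_left_mono) auto
      also have "\<dots> = ((real k + 1) * B ^ card (small m)) * real m powr \<epsilon>" by simp
      also have "\<dots> \<le> (B ^ card (small n) * real p powr (real k * \<epsilon>)) * real m powr \<epsilon>"
        using key by (intro mult_right_mono) auto
      also have "\<dots> = B ^ card (small n) * real n powr \<epsilon>"
        unfolding np by simp
      finally show ?thesis .
    qed
  qed
  show ?thesis
  proof (intro exI[of _ "B ^ card {p::nat. real p < P}"] conjI allI impI)
    show "1 \<le> B ^ card {p::nat. real p < P}" using B1 by (rule one_le_power)
    fix n :: nat assume n: "n > 0"
    have "card (small n) \<le> card {p::nat. real p < P}"
      by (rule card_mono[OF fin]) (auto simp: small_def)
    hence "B ^ card (small n) \<le> B ^ card {p::nat. real p < P}"
      using B1 by (rule power_increasing)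
    thus "real (card {d. d dvd n}) \<le> B ^ card {p::nat. real p < P} * real n powr \<epsilon>"
      using main[OF n] by (meson mult_right_mono order_trans powr_ge_zero)
  qed
qed

section \<open>Counting solutions of quadratic congruences\<close>

text \<open>Measured from the minimum in units of \<open>k\<close>, the elements become distinct
  integers between 0 and \<open>L / k\<close>.\<close>

lemma card_residue_class_le:
  fixes A :: "int set" and k :: int and L :: real
  assumes "finite A" "k > 0" "L \<ge> 0"
    and cong: "\<And>x y. x \<in> A \<Longrightarrow> y \<in> A \<Longrightarrow> k dvd x - y"
    and diam: "\<And>x y. x \<in> A \<Longrightarrow> y \<in> A \<Longrightarrow> real_of_int (x - y) \<le> L"
  shows "real (card A) \<le> 1 + L / of_int k"
proof (cases "A = {}")
  case True
  then show ?thesis using assms by simp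
next
  case False
  define a where "a = Min A"
  have a: "a \<in> A" "\<And>x. x \<in> A \<Longrightarrow> a \<le> x"
    using assms(1) False by (auto simp: a_def)
  let ?f = "\<lambda>x. (x - a) div k"
  have inj: "inj_on ?f A"
  proof (rule inj_onI)
    fix x y assume xy: "x \<in> A" "y \<in> A" "?f x = ?f y"
    have "x - a = y - a"
      using dvd_div_eq_cancel[OF xy(3)] cong a xy(1,2) by blast
    thus "x = y" by simp
  qed
  have "?f ` A \<subseteq> {0..\<lfloor>L / of_int k\<rfloor>}"
  proof
    fix z assume "z \<in> ?f ` A"
    then obtain x where x: "x \<in> A" "z = ?f x" by auto
    have "x - a = z * k" using cong[OF x(1) a(1)] x(2) by simp
    hence "real_of_int z * of_int k \<le> L"
      using diam[OF x(1) a(1)] by simp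
    hence "real_of_int z \<le> L / of_int k"
      using assms(2) by (simp add: field_simps)
    moreover have "z \<ge> 0" using x a(2)[OF x(1)] assms(2) by (simp add: pos_imp_zdiv_nonneg_iff)
    ultimately show "z \<in> {0..\<lfloor>L / of_int k\<rfloor>}" by (simp add: le_floor_iff)
  qed
  hence "card A \<le> card {0..\<lfloor>L / of_int k\<rfloor>}"
    using inj by (metis card_image card_mono finite_atLeastAtMost_int)
  moreover have "real (card {0..\<lfloor>L / of_int k\<rfloor>}) \<le> 1 + L / of_int k"
    using assms by (simp add: of_nat_nat)
  ultimately show ?thesis by linarith
qed

text \<open>
  If \<open>p\<close>, \<open>q\<close> are solutions, then \<open>r\<close> divides \<open>(q - p)(q + p)\<close>. For \<open>d = gcd (q - p) r\<close> this determines \<open>q\<close>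
  modulo \<open>lcm d (r/d) = r/h\<close>, where \<open>h = gcd d (r/d)\<close> divides \<open>2p\<close>, so that \<open>h\<^sup>2\<close> divides \<open>4m\<close>. The last
  condition is what makes the bound small on average over \<open>m\<close>.
\<close>
lemma card_quadratic_congruence_le:
  fixes A :: "int set" and b m :: int and r :: nat and L :: real
  assumes "finite A" "r > 0" "L \<ge> 0"
    and sol: "\<And>q. q \<in> A \<Longrightarrow> int r dvd b * q\<^sup>2 + m"
    and cop: "coprime b (int r)"
    and diam: "\<And>x y. x \<in> A \<Longrightarrow> y \<in> A \<Longrightarrow> real_of_int (x - y) \<le> L"
  shows "real (card A) \<le>
    (\<Sum>d | d dvd r \<and> int ((gcd d (r div d))\<^sup>2) dvd 4 * m. real (gcd d (r div d)) * (1 + L / r))"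
    (is "_ \<le> sum ?g ?D")
proof (cases "A = {}")
  case True
  then show ?thesis using assms by (auto intro!: sum_nonneg)
next
  case False
  then obtain p where p: "p \<in> A" by auto
  define B where "B d = {q \<in> A. gcd (q - p) (int r) = int d}" for d :: nat
  have finD: "finite ?D"
    by (rule finite_subset[of _ "{d. d dvd r}"]) (use assms(2) in auto)
  have step: "int (r div d) dvd q + p \<and> int d dvd q - p \<and> d dvd r" if "q \<in> B d" for q d
  proof -
    have q: "q \<in> A" "gcd (q - p) (int r) = int d" using that by (auto simp: B_def)
    have d: "d dvd r" using q(2) by (metis gcd_dvd2 int_dvd_int_iff)
    have "int r dvd (b * q\<^sup>2 + m) - (b * p\<^sup>2 + m)"
      using sol[OF q(1)] sol[OF p] by (rule dvd_diff)
    also have "(b * q\<^sup>2 + m) - (b * p\<^sup>2 + m) = b * ((q - p) * (q + p))"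
      by (simp add: algebra_simps power2_eq_square)
    finally have *: "int r dvd (q - p) * (q + p)"
      using cop by (simp add: coprime_commute coprime_dvd_mult_right_iff)
    have d0: "d > 0" using d assms(2) by (rule dvd_pos_nat[rotated])
    \<comment> \<open>Once \<open>d\<close> is cancelled, \<open>u\<close> is coprime to
      \<open>v = r / d\<close>, so \<open>v\<close> must divide the other factor
      \<open>q + p\<close>.\<close>
    obtain u where u: "q - p = int d * u" using q(2) by (metis dvdE gcd_dvd1)
    obtain v where v: "r = d * v" using d by auto
    have "int d * gcd u (int v) = int d * 1"
      using q(2) gcd_mult_distrib_int[of "int d" u "int v"] unfolding u v by simp
    hence "coprime u (int v)" using d0 unfolding mult_cancel_left by (simp add: coprime_iff_gcd_eq_1)
    moreover have "int v dvd u * (q + p)"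
      using * d0 unfolding u v by (simp add: mult.assoc)
    ultimately have "int v dvd q + p"
      by (simp add: coprime_commute coprime_dvd_mult_right_iff)
    thus ?thesis using d u v d0 by simp
  qed
  have BD: "d \<in> ?D" if "q \<in> B d" for q d
  proof -
    note st = step[OF that]
    define h where "h = gcd d (r div d)"
    have h1: "int h dvd q - p" "int h dvd q + p"
    proof -
      have "int h dvd int d" "int h dvd int (r div d)"
        unfolding h_def int_dvd_int_iff by simp_all
      thus "int h dvd q - p" "int h dvd q + p" using st by (blast intro: dvd_trans)+
    qed
    have "int h dvd (q + p) - (q - p)" using h1(2,1) by (rule dvd_diff)
    hence "int h dvd 2 * p" by simp
    hence "(int h)\<^sup>2 dvd (2 * p)\<^sup>2" by (rule dvd_power_same)
    hence a: "(int h)\<^sup>2 dvd 4 * (b * p\<^sup>2)" 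
      by (simp add: power_mult_distrib) (metis dvd_mult mult.left_commute)
    \<comment> \<open>Since \<open>h\<^sup>2\<close> divides \<open>r\<close>, it divides
      \<open>4 * (b * p\<^sup>2 + m)\<close> as well; subtracting \<open>4 * (b * p\<^sup>2)\<close>
      isolates \<open>4 * m\<close>.\<close>
    have "h * h dvd d * (r div d)" unfolding h_def by (intro mult_dvd_mono) auto
    hence "h\<^sup>2 dvd r" using st by (simp add: power2_eq_square)
    hence "(int h)\<^sup>2 dvd int r" by (metis int_dvd_int_iff of_nat_power)
    hence "(int h)\<^sup>2 dvd 4 * (b * p\<^sup>2 + m)" using sol[OF p] by (meson dvd_mult dvd_trans)
    hence "(int h)\<^sup>2 dvd 4 * (b * p\<^sup>2 + m) - 4 * (b * p\<^sup>2)" using a by (rule dvd_diff)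
    thus ?thesis using st by (simp add: h_def)
  qed
  have cardB: "real (card (B d)) \<le> ?g d" if "d \<in> ?D" for d
  proof -
    have d: "d dvd r" "d > 0" using that assms(2) by (auto intro: dvd_pos_nat)
    define h where "h = gcd d (r div d)"
    define l where "l = lcm d (r div d)"
    have lh: "l * h = r" using d unfolding l_def h_def by (simp add: lcm_mult_gcd mult.commute)
    have pos: "l > 0" "h > 0" using lh assms(2) by (auto intro: Nat.gr0I)
    have "real (card (B d)) \<le> 1 + L / of_int (int l)"
    proof (rule card_residue_class_le)
      show "finite (B d)" using assms(1) by (simp add: B_def)
      show "int l > 0" using pos by simp
      fix x y assume xy: "x \<in> B d" "y \<in> B d"
      have "int d dvd (x - p) - (y - p)" "int (r div d) dvd (x + p) - (y + p)"
        using step xy by (blast intro: dvd_diff)+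
      hence "lcm (int d) (int (r div d)) dvd x - y" by (intro lcm_least) auto
      thus "int l dvd x - y" by (simp add: l_def lcm_int_int_eq)
      show "real_of_int (x - y) \<le> L" using xy diam by (simp add: B_def)
    qed (use assms in auto)
    also have "L / of_int (int l) = real h * L / r"
      using pos by (simp flip: lh)
    \<comment> \<open>\<open>h \<ge> 1\<close> lets the factor \<open>h\<close> be pulled out of
      both terms.\<close>
    also have "1 + real h * L / r \<le> real h + real h * L / r" using pos by simp
    finally show ?thesis by (simp add: h_def algebra_simps)
  qed
  have "A \<subseteq> (\<Union>d\<in>?D. B d)"
  proof
    fix q assume q: "q \<in> A"
    have "q \<in> B (nat (gcd (q - p) (int r)))" using q by (simp add: B_def)
    thus "q \<in> (\<Union>d\<in>?D. B d)" using BD by blast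
  qed
  moreover have "finite (\<Union>d\<in>?D. B d)"
    using finD assms(1) by (auto simp: B_def)
  ultimately have "card A \<le> card (\<Union>d\<in>?D. B d)" by (intro card_mono)
  also have "\<dots> \<le> (\<Sum>d\<in>?D. card (B d))" using finD by (rule card_UN_le)
  finally have "real (card A) \<le> (\<Sum>d\<in>?D. real (card (B d)))"
    by (metis of_nat_le_iff of_nat_sum)
  also have "\<dots> \<le> sum ?g ?D" using cardB by (rule sum_mono)
  finally show ?thesis .
qed

text \<open>The quotients \<open>4 * m / k\<close> are distinct nonzero integers of size at most
  \<open>4 * X / k\<close>. Excluding 0 is what gives a bound without an additive 1, so that it
  decays like \<open>1 / k\<close>.\<close>

lemma card_multiples_le:
  fixes X :: real and k :: nat
  assumes "k > 0" "X \<ge> 0"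
  shows "finite {m::int. m \<noteq> 0 \<and> \<bar>real_of_int m\<bar> \<le> X \<and> int k dvd 4 * m}"
    and "real (card {m::int. m \<noteq> 0 \<and> \<bar>real_of_int m\<bar> \<le> X \<and> int k dvd 4 * m}) \<le> 8 * X / k"
proof -
  let ?M = "{m::int. m \<noteq> 0 \<and> \<bar>real_of_int m\<bar> \<le> X \<and> int k dvd 4 * m}"
  let ?F = "\<lfloor>4 * X / k\<rfloor>"
  let ?f = "\<lambda>m::int. (4 * m) div int k"
  have inj: "inj_on ?f ?M"
  proof (rule inj_onI)
    fix x y assume xy: "x \<in> ?M" "y \<in> ?M" "?f x = ?f y"
    have "4 * x = 4 * y"
      using dvd_div_eq_cancel[OF xy(3)] xy(1,2) by blast
    thus "x = y" by simp
  qed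
  have sub: "?f ` ?M \<subseteq> {-?F..-1} \<union> {1..?F}"
  proof
    fix z assume "z \<in> ?f ` ?M"
    then obtain m where m: "m \<in> ?M" "z = ?f m" by auto
    hence z: "4 * m = z * k" by auto
    have "z \<noteq> 0"
    proof
      assume "z = 0"
      with z have "m = 0" by simp
      with m(1) show False by simp
    qed
    have "\<bar>real_of_int z\<bar> * k = \<bar>real_of_int (z * k)\<bar>" by (simp add: abs_mult)
    also have "\<dots> = 4 * \<bar>real_of_int m\<bar>" by (simp flip: z add: abs_mult)
    also have "\<dots> \<le> 4 * X" using m by simp
    finally have "\<bar>real_of_int z\<bar> \<le> 4 * X / k" using assms by (simp add: field_simps)
    hence "\<bar>z\<bar> \<le> ?F" by (simp add: le_floor_iff)
    with \<open>z \<noteq> 0\<close> show "z \<in> {-?F..-1} \<union> {1..?F}" by auto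
  qed
  show "finite ?M"
    using finite_subset[OF sub] inj by (simp add: finite_image_iff)
  have "card ?M \<le> card ({-?F..-1} \<union> {1..?F})"
    using card_mono[OF _ sub] card_image[OF inj] by simp
  also have "\<dots> \<le> nat ?F + nat ?F"
    by (rule order_trans[OF card_Un_le]) simp
  finally have "real (card ?M) \<le> 2 * real (nat ?F)" by linarith
  also have "real (nat ?F) \<le> 4 * X / k"
    using assms by (simp add: of_nat_nat)
  finally show "real (card ?M) \<le> 8 * X / k" by simp
qed

text \<open>Exchange the sums over \<open>m\<close> and \<open>d\<close>. For fixed \<open>d\<close>
  at most \<open>8 * X / h\<^sup>2\<close> values of \<open>m\<close> survive, which outweighs the
  factor \<open>h\<close> in the number of solutions, so each divisor costs at most
  \<open>8 * X * (1 + L / r)\<close>.\<close>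

lemma card_quadratic_congruence_pairs_le:
  fixes T :: "(int \<times> int) set" and b :: int and r :: nat and L X :: real
  assumes "finite T" "r > 0" "L \<ge> 0" "X \<ge> 0"
    and sol: "\<And>m q. (m, q) \<in> T \<Longrightarrow> int r dvd b * q\<^sup>2 + m"
    and bound: "\<And>m q. (m, q) \<in> T \<Longrightarrow> m \<noteq> 0 \<and> \<bar>real_of_int m\<bar> \<le> X"
    and cop: "coprime b (int r)"
    and diam: "\<And>m x y. (m, x) \<in> T \<Longrightarrow> (m, y) \<in> T \<Longrightarrow> real_of_int (x - y) \<le> L"
  shows "real (card T) \<le> 8 * X * (1 + L / r) * card {d. d dvd r}"
proof -
  define h where "h d = gcd d (r div d)" for d
  define M where "M = {m::int. m \<noteq> 0 \<and> \<bar>real_of_int m\<bar> \<le> X}"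
  have finM: "finite M" using card_multiples_le(1)[of 1 X] assms(4) by (simp add: M_def)
  have finD: "finite {d. d dvd r}" using assms(2) by simp
  let ?A = "\<lambda>m. {q. (m, q) \<in> T}"
  have finA: "finite (?A m)" for m
    by (rule finite_subset[of _ "snd ` T"]) (use assms(1) in \<open>auto simp: image_iff\<close>, force)
  have "T = Sigma M ?A" using bound by (auto simp: M_def)
  hence "card T = (\<Sum>m\<in>M. card (?A m))"
    using finM finA by (metis card_SigmaI)
  hence "real (card T) = (\<Sum>m\<in>M. real (card (?A m)))" by simp
  also have "\<dots> \<le> (\<Sum>m\<in>M. \<Sum>d | d dvd r \<and> int ((h d)\<^sup>2) dvd 4 * m. real (h d) * (1 + L / r))"
    unfolding h_def
    by (intro sum_mono card_quadratic_congruence_le[where b = b]) (use assms finA in auto)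
  also have "\<dots> = (\<Sum>d | d dvd r. \<Sum>m | m \<in> M \<and> int ((h d)\<^sup>2) dvd 4 * m. real (h d) * (1 + L / r))"
    using sum.swap_restrict[OF finM finD, of "\<lambda>m d. real (h d) * (1 + L / r)" "\<lambda>m d. int ((h d)\<^sup>2) dvd 4 * m"]
    by simp
  also have "\<dots> \<le> (\<Sum>d | d dvd r. 8 * X * (1 + L / r))"
  proof (rule sum_mono)
    fix d assume "d \<in> {d. d dvd r}"
    hence "h d > 0" using assms(2) by (auto simp: h_def)
    hence "real (card {m. m \<in> M \<and> int ((h d)\<^sup>2) dvd 4 * m}) \<le> 8 * X / (h d)\<^sup>2"
      using card_multiples_le(2)[of "(h d)\<^sup>2" X] assms(4) by (simp add: M_def conj_assoc)
    hence "real (card {m. m \<in> M \<and> int ((h d)\<^sup>2) dvd 4 * m}) * (real (h d) * (1 + L / r)) \<le>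
        8 * X / (h d)\<^sup>2 * (real (h d) * (1 + L / r))"
      using assms by (intro mult_right_mono) auto
    also have "\<dots> = 8 * X * (1 + L / r) / h d"
      using \<open>h d > 0\<close> by (simp add: power2_eq_square)
    also have "\<dots> \<le> 8 * X * (1 + L / r)"
      using \<open>h d > 0\<close> assms frac_le[of "8 * X * (1 + L / r)" "8 * X * (1 + L / r)" 1 "h d"] by simp
    finally show "(\<Sum>m | m \<in> M \<and> int ((h d)\<^sup>2) dvd 4 * m. real (h d) * (1 + L / r)) \<le> 8 * X * (1 + L / r)"
      by simp
  qed
  also have "\<dots> = 8 * X * (1 + L / r) * card {d. d dvd r}" by simp
  finally show ?thesis .
qed

section \<open>Fractions with square denominator in short intervals\<close>

lemma card_fractions_square_denominator_near_le:
  fixes Q \<beta> :: real and N :: nat and T :: "(int \<times> int) set"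
  assumes "N \<ge> 1" "Q \<ge> 1" "finite T"
    and T: "\<And>q a. (q, a) \<in> T \<Longrightarrow> 1 \<le> q \<and> real_of_int q \<le> Q \<and> coprime a q \<and>
      \<bar>real_of_int a / (real_of_int q)\<^sup>2 - \<beta>\<bar> \<le> 1 / N"
  obtains r :: nat where "0 < r" "r \<le> N"
    "real (card T) \<le> 1 + (24 * Q\<^sup>2 / sqrt N + 48 * Q ^ 3 / N) * card {d. d dvd r}"
proof -
  define P where "P = nat \<lfloor>sqrt N\<rfloor>"
  have sN: "sqrt N \<ge> 1" using assms(1) by simp
  have sNN: "sqrt N * sqrt N = N" by simp
  have "real_of_int \<lfloor>sqrt N\<rfloor> \<ge> 1" using sN by (simp add: le_floor_iff)
  have Preal: "real P = real_of_int \<lfloor>sqrt N\<rfloor>" using sN by (simp add: P_def of_nat_nat)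
  have P: "P \<ge> 1" "real P \<le> sqrt N" "sqrt N \<le> 2 * real P"
    using Preal \<open>real_of_int \<lfloor>sqrt N\<rfloor> \<ge> 1\<close> of_int_floor_le[of "sqrt N"]
      real_of_int_floor_add_one_ge[of "sqrt N"] by linarith+
  obtain b k' where *: "coprime b k'" "0 < k'" "k' \<le> int P" "\<bar>of_int k' * \<beta> - of_int b\<bar> < 1 / P"
    using Dirichlet_approx_coprime[of P \<beta>] P(1) by auto
  define r where "r = nat k'"
  have k': "k' = int r" using *(2) by (simp add: r_def)
  have r: "r > 0" "real r \<le> sqrt N" "coprime b (int r)"
    using * P(2) unfolding k' by auto
  define z where "z = \<beta> - b / r"
  \<comment> \<open>The lower limit \<open>2 / N\<close> makes \<open>1 / N \<le> y / 2\<close>, so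
    perturbing by \<open>1 / N\<close> changes \<open>y\<close> by at most half of itself.\<close>
  define y where "y = max \<bar>z\<bar> (2 / N)"
  have y0: "y > 0" using assms(1) by (simp add: y_def less_max_iff_disj)
  have ry: "r * y \<le> 2 / sqrt N"
  proof -
    have "r * z = r * \<beta> - b" using r by (simp add: z_def field_simps)
    hence "\<bar>r * z\<bar> < 1 / P" using *(4) unfolding k' by simp
    also have "1 / P \<le> 2 / sqrt N"
    proof -
      have "0 < real P" "0 < sqrt N" using P sN by linarith+
      thus ?thesis using P(3) by (simp add: divide_simps)
    qed
    finally have "r * \<bar>z\<bar> \<le> 2 / sqrt N" by (simp add: abs_mult)
    moreover have "r * (2 / N) \<le> sqrt N * (2 / N)" using r by (intro mult_right_mono) auto
    moreover have "sqrt N * (2 / N) = 2 / sqrt N"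
      using sN sNN by (simp add: field_simps)
    ultimately show ?thesis unfolding y_def max_def by simp
  qed
  \<comment> \<open>The numerator of \<open>a / q\<^sup>2 - b / r\<close> over the denominator
    \<open>r * q\<^sup>2\<close>.\<close>
  define m where "m = (\<lambda>(q, a). a * int r - b * q\<^sup>2)"
  have m_eq: "real_of_int (m (q, a)) = r * (real_of_int q)\<^sup>2 * (real_of_int a / (real_of_int q)\<^sup>2 - \<beta> + z)"
    if "(q, a) \<in> T" for q a
    using T[OF that] r by (simp add: m_def z_def field_simps)
  define T0 where "T0 = {t \<in> T. m t = 0}"
  define T1 where "T1 = {t \<in> T. m t \<noteq> 0}"
  \<comment> \<open>Here \<open>m = 0\<close>: two fractions in lowest terms agree, hence so do
    their numerators and denominators.\<close>
  have eq_iff: "q\<^sup>2 = int r \<and> a = b" if "(q, a) \<in> T0" for q a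
  proof -
    have qa: "(q, a) \<in> T" "a * int r = b * q\<^sup>2" using that by (auto simp: T0_def m_def)
    have "coprime (q\<^sup>2) a" using T[OF qa(1)] by (simp add: coprime_commute)
    moreover have "q\<^sup>2 dvd a * int r" unfolding qa(2) by simp
    ultimately have "q\<^sup>2 dvd int r" by (simp add: coprime_dvd_mult_right_iff)
    moreover have "int r dvd q\<^sup>2"
      using r(3) dvd_triv_right[of "int r" a] unfolding qa(2)
      by (simp add: coprime_commute coprime_dvd_mult_right_iff)
    ultimately have "q\<^sup>2 = int r" by (intro zdvd_antisym_nonneg) auto
    thus ?thesis using qa(2) r(1) by auto
  qed
  have "card T0 \<le> Suc 0"
  proof (subst card_le_Suc0_iff_eq)
    show "\<forall>s\<in>T0. \<forall>t\<in>T0. s = t"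
    proof safe
      fix q a q' a' assume st: "(q, a) \<in> T0" "(q', a') \<in> T0"
      hence "q\<^sup>2 = q'\<^sup>2" "a = a'" using eq_iff by metis+
      moreover have "q \<ge> 0" "q' \<ge> 0" using T st by (force simp: T0_def)+
      ultimately show "q = q'" "a = a'" by auto
    qed
  qed (use assms(3) in \<open>simp add: T0_def\<close>)
  \<comment> \<open>\<open>X\<close> bounds \<open>|m|\<close>, from \<open>q \<le> Q\<close> and
    \<open>|z| + 1 / N \<le> 3 / 2 * y\<close>; \<open>L\<close> bounds the spread of the
    \<open>q\<close> that share one value of \<open>m\<close>.\<close>
  define X where "X = 3 / 2 * r * Q\<^sup>2 * y"
  define L where "L = 4 * Q / (N * y)"
  let ?f = "\<lambda>t. (m t, fst t)"
  have inj: "inj_on ?f T1"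
    using r by (auto simp: inj_on_def m_def)
  have "real (card (?f ` T1)) \<le> 8 * X * (1 + L / r) * card {d. d dvd r}"
  proof (rule card_quadratic_congruence_pairs_le[where b = b])
    show "finite (?f ` T1)" using assms(3) by (simp add: T1_def)
    show "0 < r" "coprime b (int r)" using r by auto
    show "0 \<le> X" "0 \<le> L" using y0 assms by (auto simp: X_def L_def)
  next
    fix c q assume "(c, q) \<in> ?f ` T1"
    then obtain a where a: "(q, a) \<in> T1" "c = m (q, a)" by auto
    show "int r dvd b * q\<^sup>2 + c" unfolding a(2) by (simp add: m_def)
    have aT: "(q, a) \<in> T" using a by (simp add: T1_def)
    have "\<bar>real_of_int a / (real_of_int q)\<^sup>2 - \<beta> + z\<bar> \<le> 3 / 2 * y"
      using T[OF aT] unfolding y_def by linarith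
    moreover have "(real_of_int q)\<^sup>2 \<le> Q\<^sup>2"
      using T[OF aT] by (intro power_mono) auto
    ultimately have "r * (real_of_int q)\<^sup>2 * \<bar>real_of_int a / (real_of_int q)\<^sup>2 - \<beta> + z\<bar>
        \<le> r * Q\<^sup>2 * (3 / 2 * y)"
      by (intro mult_mono mult_left_mono) auto
    thus "c \<noteq> 0 \<and> \<bar>real_of_int c\<bar> \<le> X"
      using a(1) unfolding a(2) m_eq[OF aT] by (simp add: abs_mult X_def T1_def mult_ac)
  next
    fix c u v assume uv: "(c, u) \<in> ?f ` T1" "(c, v) \<in> ?f ` T1"
    from uv obtain a where a: "(u, a) \<in> T" "c = m (u, a)" by (auto simp: T1_def)
    from uv obtain a' where a': "(v, a') \<in> T" "c = m (v, a')" by (auto simp: T1_def)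
    show "real_of_int (u - v) \<le> L"
    proof (cases "\<bar>z\<bar> \<le> 2 / N")
      \<comment> \<open>Here \<open>y = 2 / N\<close>, so \<open>L = 2 * Q\<close> and the range of
        \<open>q\<close> suffices.\<close>
      case True
      hence "L = 2 * Q" using assms(1) by (simp add: L_def y_def)
      thus ?thesis using T[OF a(1)] T[OF a'(1)] assms(2) by simp
    next
      case False
      hence y: "y = \<bar>z\<bar>" by (simp add: y_def)
      \<comment> \<open>Equal values of \<open>m\<close> give
        \<open>u\<^sup>2 * s = v\<^sup>2 * s'\<close>. As \<open>|s|\<close> and \<open>|s'|\<close>
        both lie within \<open>1 / N\<close> of \<open>y\<close>, the squares
        \<open>u\<^sup>2\<close> and \<open>v\<^sup>2\<close> are nearly equal.\<close>
      define s where "s = real_of_int a / (real_of_int u)\<^sup>2 - \<beta> + z"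
      define s' where "s' = real_of_int a' / (real_of_int v)\<^sup>2 - \<beta> + z"
      have s: "\<bar>s\<bar> \<ge> y - 1 / N" "\<bar>s'\<bar> \<le> y + 1 / N"
        using T[OF a(1)] T[OF a'(1)] unfolding s_def s'_def y by linarith+
      have "r * (real_of_int u)\<^sup>2 * s = r * (real_of_int v)\<^sup>2 * s'"
        using m_eq[OF a(1)] m_eq[OF a'(1)] a(2) a'(2) unfolding s_def s'_def by simp
      hence "(real_of_int u)\<^sup>2 * s = (real_of_int v)\<^sup>2 * s'" using r by simp
      hence "\<bar>(real_of_int u)\<^sup>2 * s\<bar> = \<bar>(real_of_int v)\<^sup>2 * s'\<bar>" by simp
      hence eq: "(real_of_int u)\<^sup>2 * \<bar>s\<bar> = (real_of_int v)\<^sup>2 * \<bar>s'\<bar>" by (simp add: abs_mult)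
      have pos: "real_of_int u \<ge> 1" "real_of_int v \<ge> 1" "real_of_int v \<le> Q"
        using T[OF a(1)] T[OF a'(1)] by auto
      show ?thesis
      proof (cases "u \<le> v")
        case True
        have "L \<ge> 0" using y0 assms by (simp add: L_def)
        moreover have "real_of_int (u - v) \<le> 0" using True by simp
        ultimately show ?thesis by linarith
      next
        case False
        define U V where "U = real_of_int u" and "V = real_of_int v"
        have UV: "V < U" "V \<ge> 1" "V \<le> Q" using False pos by (auto simp: U_def V_def)
        have "U\<^sup>2 * (y - 1 / N) \<le> U\<^sup>2 * \<bar>s\<bar>" using s by (intro mult_left_mono) auto
        also have "\<dots> = V\<^sup>2 * \<bar>s'\<bar>" using eq by (simp add: U_def V_def)
        also have "\<dots> \<le> V\<^sup>2 * (y + 1 / N)" using s by (intro mult_left_mono) auto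
        finally have "(U\<^sup>2 - V\<^sup>2) * (y - 1 / N) \<le> V\<^sup>2 * (2 / N)"
          by (simp add: algebra_simps)
        moreover have "(U\<^sup>2 - V\<^sup>2) * (y / 2) \<le> (U\<^sup>2 - V\<^sup>2) * (y - 1 / N)"
          using UV \<open>\<not> \<bar>z\<bar> \<le> 2 / N\<close> unfolding y
          by (intro mult_left_mono) (auto intro!: power_mono)
        moreover have "V\<^sup>2 * (2 / N) \<le> (U + V) * (Q * (2 / N))"
        proof -
          have "V * V \<le> (U + V) * Q" using UV by (intro mult_mono) auto
          thus ?thesis using mult_right_mono[of "V * V" "(U + V) * Q" "2 / N"]
            by (simp add: power2_eq_square mult_ac)
        qed
        \<comment> \<open>Factoring \<open>U\<^sup>2 - V\<^sup>2\<close> and cancelling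
          \<open>U + V\<close> turns this into \<open>U - V \<le> 4 * Q / (N * y)\<close>, which is
          \<open>L\<close>.\<close>
        ultimately have "(U\<^sup>2 - V\<^sup>2) * (y / 2) \<le> (U + V) * (Q * (2 / N))"
          by linarith
        moreover have "U\<^sup>2 - V\<^sup>2 = (U + V) * (U - V)"
          by (simp add: power2_eq_square algebra_simps)
        ultimately have "(U + V) * ((U - V) * (y / 2)) \<le> (U + V) * (Q * (2 / N))"
          by (simp only: mult.assoc)
        hence "(U - V) * (y / 2) \<le> Q * (2 / N)"
          by (rule mult_left_le_imp_le) (use UV in simp)
        thus ?thesis using y0 assms(1) by (simp add: L_def U_def V_def field_simps)
      qed
    qed
  qed
  hence T1: "real (card T1) \<le> 8 * X * (1 + L / r) * card {d. d dvd r}"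
    using card_image[OF inj] by simp
  \<comment> \<open>In \<open>X * L / r\<close> both \<open>r\<close> and \<open>y\<close> cancel;
    in \<open>X\<close> itself only the product \<open>r * y\<close> remains, which Dirichlet's
    theorem controls.\<close>
  have "8 * X * (1 + L / r) = 12 * Q\<^sup>2 * (r * y) + 48 * Q ^ 3 / N"
    using r y0 assms(1) by (simp add: X_def L_def field_simps power2_eq_square power3_eq_cube)
  also have "\<dots> \<le> 12 * Q\<^sup>2 * (2 / sqrt N) + 48 * Q ^ 3 / N"
    using ry by (intro add_mono mult_left_mono) auto
  finally have "8 * X * (1 + L / r) \<le> 24 * Q\<^sup>2 / sqrt N + 48 * Q ^ 3 / N" by simp
  hence "8 * X * (1 + L / r) * card {d. d dvd r} \<le> (24 * Q\<^sup>2 / sqrt N + 48 * Q ^ 3 / N) * card {d. d dvd r}"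
    by (intro mult_right_mono) auto
  moreover have "card T \<le> card T0 + card T1"
    using card_Un_le[of T0 T1] by (simp add: T0_def T1_def Collect_disj_eq[symmetric] conj_disj_distribL[symmetric])
  ultimately have "real (card T) \<le> 1 + (24 * Q\<^sup>2 / sqrt N + 48 * Q ^ 3 / N) * card {d. d dvd r}"
    using T1 \<open>card T0 \<le> Suc 0\<close> by linarith
  moreover have "r \<le> N"
  proof -
    have "sqrt N \<le> N" using mult_left_mono[OF sN, of "sqrt N"] sNN by simp
    thus ?thesis using r by linarith
  qed
  ultimately show thesis using that r by blast
qed

section \<open>The large sieve\<close>

lemma e_eq_cis: "e x = cis (2 * pi * x)"
  by (simp add: e_def cis_conv_exp mult_ac)

lemma norm_e [simp]: "cmod (e x) = 1"
  by (simp add: e_eq_cis)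

lemma e_add: "e (x + y) = e x * e y"
  by (simp add: e_eq_cis cis_mult distrib_left)

lemma cnj_e: "cnj (e x) = e (- x)"
  by (simp add: e_eq_cis cis_cnj)

lemma e_of_int [simp]: "e (of_int n) = 1"
  by (simp add: e_eq_cis cis_multiple_2pi)

lemma e_of_nat_mult: "e (real j * x) = e x ^ j"
  unfolding e_eq_cis Complex.DeMoivre by (simp add: mult_ac)

lemma e_frac: "e (frac x) = e x"
proof -
  have "e x = e (frac x + of_int \<lfloor>x\<rfloor>)" by (simp add: frac_def)
  also have "\<dots> = e (frac x)" by (simp only: e_add e_of_int mult_1_right)
  finally show ?thesis by simp
qed

text \<open>Jordan's inequality: sine is concave on \<open>[0, pi]\<close>, so it lies above its
  chord from 0 to \<open>pi / 2\<close>.\<close>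

lemma two_mult_le_sin_pi:
  fixes t :: real
  assumes "0 \<le> t" "t \<le> 1 / 2"
  shows "2 * t \<le> sin (pi * t)"
proof -
  have "convex_on {0..pi} (\<lambda>x. - sin x)"
    by (rule f''_ge0_imp_convex[where f' = "\<lambda>x. - cos x" and f'' = sin])
       (auto intro!: derivative_eq_intros sin_ge_zero)
  from convex_onD[OF this, of "2 * t" 0 "pi / 2"] assms
  show ?thesis by (simp add: mult_ac)
qed

lemma norm_e_minus_one: "cmod (e t - 1) = 2 * \<bar>sin (pi * t)\<bar>"
proof -
  have "(cmod (e t - 1))\<^sup>2 = (cos (2 * (pi * t)) - 1)\<^sup>2 + (sin (2 * (pi * t)))\<^sup>2"
    by (simp add: cmod_power2 e_eq_cis mult_ac)
  also have "\<dots> = 2 - 2 * cos (2 * (pi * t))"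
    using sin_cos_squared_add[of "2 * (pi * t)"] by (simp add: power2_eq_square algebra_simps)
  also have "\<dots> = (2 * \<bar>sin (pi * t)\<bar>)\<^sup>2"
    by (simp add: cos_double_sin power_mult_distrib)
  finally show ?thesis by (rule power2_eq_imp_eq) auto
qed

lemma norm_e_minus_one_ge:
  assumes "0 \<le> t" "t \<le> 1"
  shows "4 * min t (1 - t) \<le> cmod (e t - 1)"
proof (cases "t \<le> 1 / 2")
  case True
  then show ?thesis using two_mult_le_sin_pi[of t] assms unfolding norm_e_minus_one by linarith
next
  case False
  have "sin (pi * (1 - t)) = sin (pi * t)"
    by (simp add: right_diff_distrib sin_diff)
  then show ?thesis
    using two_mult_le_sin_pi[of "1 - t"] False assms unfolding norm_e_minus_one by linarith
qed

text \<open>Multiplication by \<open>e x - 1\<close> telescopes the sum, and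
  \<open>|e x - 1|\<close> is at least four times the distance from \<open>x\<close> to the nearest
  integer. The product form also covers integral \<open>x\<close>.\<close>

lemma norm_geometric_sum_e_le:
  "cmod (\<Sum>j<L. e (real j * x)) * (2 * min (frac x) (1 - frac x)) \<le> 1"
proof -
  have "(\<Sum>j<L. e (real j * x)) * (e x - 1) = e x ^ L - 1"
    unfolding e_of_nat_mult power_diff_1_eq by (rule mult.commute)
  hence "cmod (\<Sum>j<L. e (real j * x)) * cmod (e x - 1) = cmod (e x ^ L - 1)"
    by (metis norm_mult)
  also have "\<dots> \<le> 2"
    by (rule order_trans[OF norm_triangle_ineq4]) (simp add: norm_power)
  finally have "cmod (\<Sum>j<L. e (real j * x)) * cmod (e (frac x) - 1) \<le> 2"
    by (simp add: e_frac)
  moreover have "4 * min (frac x) (1 - frac x) \<le> cmod (e (frac x) - 1)"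
    by (rule norm_e_minus_one_ge) (auto simp: frac_lt_1 less_imp_le)
  hence "cmod (\<Sum>j<L. e (real j * x)) * (4 * min (frac x) (1 - frac x)) \<le>
      cmod (\<Sum>j<L. e (real j * x)) * cmod (e (frac x) - 1)"
    by (intro mult_left_mono) auto
  ultimately show ?thesis by linarith
qed

text \<open>The term for \<open>j = 0\<close> is \<open>1 / 0 = 0\<close>.\<close>
lemma sum_inverse_squares_le: "(\<Sum>j<n. 1 / (real j)\<^sup>2) \<le> 2"
proof -
  \<comment> \<open>The terms 0 and 1 form the base case; afterwards
    \<open>1 / (n + 2)\<^sup>2\<close> is dominated by a telescoping difference.\<close>
  have *: "(\<Sum>j<n + 2. 1 / (real j)\<^sup>2) \<le> 2 - 1 / (real n + 1)" for n
  proof (induction n)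
    case (Suc n)
    have "1 / (real n + 2)\<^sup>2 \<le> 1 / ((real n + 1) * (real n + 2))"
      unfolding power2_eq_square by (intro divide_left_mono mult_right_mono) auto
    also have "\<dots> = 1 / (real n + 1) - 1 / (real n + 2)"
      by (simp add: field_simps)
    finally show ?case using Suc by (simp add: add_ac)
  qed (simp add: numeral_2_eq_2)
  have "(\<Sum>j<n. 1 / (real j)\<^sup>2) \<le> (\<Sum>j<n + 2. 1 / (real j)\<^sup>2)"
    by (rule sum_mono2) auto
  also have "\<dots> \<le> 2" using *[of n] by (smt (verit) divide_nonneg_nonneg of_nat_0_le_iff)
  finally show ?thesis .
qed

text \<open>Sort the points modulo 1 into \<open>N\<close> cells of length \<open>1 / N\<close>
  starting at \<open>\<beta>\<close>, each holding at most \<open>K\<close> points. The kernel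
  decays like the inverse distance to \<open>\<beta>\<close>, so its squares are summable over the
  cells. The constant is \<open>9 = 4 + 4 + 1/2 + 1/2\<close>.\<close>

lemma sum_norm_geometric_sum_e_le:
  fixes \<alpha> :: "'i \<Rightarrow> real" and \<beta> K :: real and N :: nat
  assumes "finite R" "N \<ge> 1"
    and K: "\<And>\<beta>. real (card {s \<in> R. frac (\<alpha> s - \<beta>) < 1 / N}) \<le> K"
  shows "(\<Sum>s\<in>R. (cmod (\<Sum>j<2 * N. e (real j * (\<alpha> s - \<beta>))))\<^sup>2) \<le> 9 * K * (real N)\<^sup>2"
proof -
  define D where "D x = cmod (\<Sum>j<2 * N. e (real j * x))" for x
  define i where "i s = nat \<lfloor>N * frac (\<alpha> s - \<beta>)\<rfloor>" for s
  \<comment> \<open>At the two ends \<open>j = 0\<close> and \<open>j = N - 1\<close> one quotient is \<open>1 / 0 = 0\<close>; there the trivial bound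
    \<open>(2N)\<^sup>2\<close> takes over.\<close>
  define g where "g j = (if j = 0 then 4 * (real N)\<^sup>2 else 0) + (if j = N - 1 then 4 * (real N)\<^sup>2 else 0)
    + (real N)\<^sup>2 / 4 * (1 / (real j)\<^sup>2) + (real N)\<^sup>2 / 4 * (1 / (real (N - Suc j))\<^sup>2)" for j
  have g0: "g j \<ge> 0" for j by (simp add: g_def)
  have i: "real (i s) \<le> N * frac (\<alpha> s - \<beta>)" "N * frac (\<alpha> s - \<beta>) < real (i s) + 1" "i s < N" for s
  proof -
    have nn: "N * frac (\<alpha> s - \<beta>) \<ge> 0" by simp
    have "real (i s) = of_int \<lfloor>N * frac (\<alpha> s - \<beta>)\<rfloor>" using nn by (simp add: i_def of_nat_nat)
    thus 1: "real (i s) \<le> N * frac (\<alpha> s - \<beta>)" "N * frac (\<alpha> s - \<beta>) < real (i s) + 1"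
      by linarith+
    have "N * frac (\<alpha> s - \<beta>) < N" using assms(2) frac_lt_1[of "\<alpha> s - \<beta>"] by simp
    thus "i s < N" using 1 by linarith
  qed
  have D_le: "(D (\<alpha> s - \<beta>))\<^sup>2 \<le> g (i s)" for s
  proof (cases "i s = 0 \<or> i s = N - 1")
    case True
    have "D (\<alpha> s - \<beta>) \<le> real (2 * N)"
      unfolding D_def by (rule order_trans[OF norm_sum]) simp
    hence "(D (\<alpha> s - \<beta>))\<^sup>2 \<le> (real (2 * N))\<^sup>2"
      by (intro power_mono) (auto simp: D_def)
    also have "\<dots> = 4 * (real N)\<^sup>2" by simp
    also have "\<dots> \<le> g (i s)" using True by (auto simp: g_def)
    finally show ?thesis .
  next
    case False
    define t where "t = frac (\<alpha> s - \<beta>)"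
    have N: "real (N - Suc (i s)) = real N - 1 - i s" using i(3)[of s] by simp
    have pos: "real (i s) > 0" "real (N - Suc (i s)) > 0" using False i(3)[of s] by auto
    have t: "real (i s) / N \<le> t" "real (N - Suc (i s)) / N \<le> 1 - t"
      using i(1,2)[of s] assms(2) unfolding t_def N by (simp_all add: field_simps)
    have D: "D (\<alpha> s - \<beta>) * (2 * min t (1 - t)) \<le> 1"
      unfolding D_def t_def by (rule norm_geometric_sum_e_le)
    have aux: "(D (\<alpha> s - \<beta>))\<^sup>2 \<le> (real N)\<^sup>2 / 4 * (1 / (real k)\<^sup>2)"
      if "real k / N \<le> min t (1 - t)" "real k > 0" for k
    proof -
      have "D (\<alpha> s - \<beta>) * (2 * (real k / N)) \<le> D (\<alpha> s - \<beta>) * (2 * min t (1 - t))"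
        using that by (intro mult_left_mono) (auto simp: D_def)
      with D have "D (\<alpha> s - \<beta>) * (2 * (real k / N)) \<le> 1" by linarith
      hence "D (\<alpha> s - \<beta>) \<le> N / (2 * k)" using that assms(2) by (simp add: field_simps)
      hence "(D (\<alpha> s - \<beta>))\<^sup>2 \<le> (N / (2 * k))\<^sup>2"
        by (intro power_mono) (auto simp: D_def)
      thus ?thesis by (simp add: power_divide power_mult_distrib)
    qed
    have "(D (\<alpha> s - \<beta>))\<^sup>2 \<le>
      (real N)\<^sup>2 / 4 * (1 / (real (i s))\<^sup>2) + (real N)\<^sup>2 / 4 * (1 / (real (N - Suc (i s)))\<^sup>2)"
    proof (cases "t \<le> 1 - t")
      case True
      show ?thesis using aux[of "i s"] t pos True by (intro add_increasing2) auto
    next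
      case False
      show ?thesis using aux[of "N - Suc (i s)"] t pos False by (intro add_increasing) auto
    qed
    thus ?thesis using False by (simp add: g_def)
  qed
  have "K \<ge> 0" using K[of 0] by (meson of_nat_0_le_iff order_trans)
  have cardi: "real (card {s \<in> R. i s = j}) \<le> K" for j
  proof -
    \<comment> \<open>Cell \<open>j\<close> is an interval of length \<open>1 / N\<close> starting
      at \<open>\<beta> + j / N\<close>, so the hypothesis on \<open>K\<close> applies with this
      shifted centre.\<close>
    have "{s \<in> R. i s = j} \<subseteq> {s \<in> R. frac (\<alpha> s - (\<beta> + j / N)) < 1 / N}"
    proof safe
      fix s assume "s \<in> R" "j = i s"
      define t where "t = frac (\<alpha> s - \<beta>)"
      have "frac (\<alpha> s - (\<beta> + i s / N)) = t - i s / N"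
      proof (subst frac_unique_iff, intro conjI)
        have "\<alpha> s - (\<beta> + i s / N) - (t - i s / N) = of_int \<lfloor>\<alpha> s - \<beta>\<rfloor>"
          by (simp add: t_def frac_def)
        thus "\<alpha> s - (\<beta> + i s / N) - (t - i s / N) \<in> \<int>" by simp
        show "0 \<le> t - i s / N" using i(1)[of s] assms(2) by (simp add: t_def field_simps)
        have "t < 1" "0 \<le> i s / N" by (auto simp: t_def frac_lt_1)
        thus "t - i s / N < 1" by linarith
      qed
      also have "t < (real (i s) + 1) / N"
        using i(2)[of s] assms(2) by (simp add: t_def pos_less_divide_eq mult.commute)
      hence "t - i s / N < 1 / N" by (simp add: add_divide_distrib)
      finally show "frac (\<alpha> s - (\<beta> + i s / N)) < 1 / N" .
    qed
    hence "card {s \<in> R. i s = j} \<le> card {s \<in> R. frac (\<alpha> s - (\<beta> + j / N)) < 1 / N}"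
      using assms(1) by (intro card_mono) auto
    thus ?thesis using K[of "\<beta> + j / N"] by linarith
  qed
  have "(\<Sum>s\<in>R. (D (\<alpha> s - \<beta>))\<^sup>2) \<le> (\<Sum>s\<in>R. g (i s))"
    by (intro sum_mono D_le)
  also have "\<dots> = (\<Sum>j<N. \<Sum>s | s \<in> R \<and> i s = j. g (i s))"
    using assms(1) i(3) by (intro sum.group[symmetric]) auto
  also have "\<dots> = (\<Sum>j<N. real (card {s \<in> R. i s = j}) * g j)"
    by (intro sum.cong) auto
  also have "\<dots> \<le> (\<Sum>j<N. K * g j)"
    using cardi g0 by (intro sum_mono mult_right_mono) auto
  also have "\<dots> = K * (\<Sum>j<N. g j)" by (simp add: sum_distrib_left)
  finally have le: "(\<Sum>s\<in>R. (D (\<alpha> s - \<beta>))\<^sup>2) \<le> K * (\<Sum>j<N. g j)" .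
  have "(\<Sum>j<N. g j) = 8 * (real N)\<^sup>2 + (real N)\<^sup>2 / 4 * (\<Sum>j<N. 1 / (real j)\<^sup>2)
     + (real N)\<^sup>2 / 4 * (\<Sum>j<N. 1 / (real (N - Suc j))\<^sup>2)"
    using assms(2) unfolding g_def sum.distrib sum_distrib_left[symmetric] by (simp add: sum.delta)
  also have "(\<Sum>j<N. 1 / (real (N - Suc j))\<^sup>2) = (\<Sum>j<N. 1 / (real j)\<^sup>2)"
    by (rule sum.nat_diff_reindex)
  also have "8 * (real N)\<^sup>2 + (real N)\<^sup>2 / 4 * (\<Sum>j<N. 1 / (real j)\<^sup>2) + (real N)\<^sup>2 / 4 * (\<Sum>j<N. 1 / (real j)\<^sup>2)
     \<le> 8 * (real N)\<^sup>2 + (real N)\<^sup>2 / 4 * 2 + (real N)\<^sup>2 / 4 * 2"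
    by (intro add_mono mult_left_mono sum_inverse_squares_le) auto
  also have "\<dots> = 9 * (real N)\<^sup>2" by simp
  finally have "(\<Sum>j<N. g j) \<le> 9 * (real N)\<^sup>2" .
  hence "K * (\<Sum>j<N. g j) \<le> 9 * K * (real N)\<^sup>2"
    using mult_left_mono[OF _ \<open>K \<ge> 0\<close>] by fastforce
  with le show ?thesis by (simp add: D_def)
qed

text \<open>Averaging over differences \<open>j - k\<close> makes the coefficient of
  \<open>c r * cnj (c s)\<close> the nonnegative \<open>|D|\<^sup>2\<close>. The quadratic form is
  then bounded by its largest row sum, which is the preceding lemma with
  \<open>\<beta> = \<alpha> r\<close>.\<close>

lemma dual_large_sieve:
  fixes \<alpha> :: "'i \<Rightarrow> real" and c :: "'i \<Rightarrow> complex" and K :: real and N :: nat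
  assumes "finite R" "N \<ge> 1"
    and K: "\<And>\<beta>. real (card {s \<in> R. frac (\<alpha> s - \<beta>) < 1 / N}) \<le> K"
  shows "(\<Sum>n<N. (cmod (\<Sum>r\<in>R. c r * e (real n * \<alpha> r)))\<^sup>2) \<le> 9 * K * N * (\<Sum>r\<in>R. (cmod (c r))\<^sup>2)"
proof -
  define G where "G x = (\<Sum>r\<in>R. c r * e (x * \<alpha> r))" for x :: real
  define D where "D x = (\<Sum>j<2 * N. e (real j * x))" for x
  have D_minus: "cmod (D (- x)) = cmod (D x)" for x
  proof -
    have "D (- x) = cnj (D x)" by (simp add: D_def cnj_e)
    thus ?thesis by simp
  qed
  \<comment> \<open>The Fejer kernel in the form of a sum over pairs: every \<open>n < N\<close> is a difference \<open>j - k\<close> of at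
    least \<open>N\<close> pairs \<open>j, k < 2N\<close>.\<close>
  have "N * (\<Sum>n<N. (cmod (G n))\<^sup>2) = (\<Sum>(n, k)\<in>{..<N} \<times> {..<N}. (cmod (G n))\<^sup>2)"
    by (simp add: sum.cartesian_product[symmetric] sum_distrib_left)
  also have "\<dots> = (\<Sum>(j, k)\<in>(\<lambda>(n, k). (n + k, k)) ` ({..<N} \<times> {..<N}). (cmod (G (real j - real k)))\<^sup>2)"
    by (subst sum.reindex) (auto simp: inj_on_def intro!: sum.cong)
  also have "\<dots> \<le> (\<Sum>(j, k)\<in>{..<2 * N} \<times> {..<2 * N}. (cmod (G (real j - real k)))\<^sup>2)"
    by (rule sum_mono2) auto
  finally have 1: "N * (\<Sum>n<N. (cmod (G n))\<^sup>2) \<le> (\<Sum>j<2 * N. \<Sum>k<2 * N. (cmod (G (real j - real k)))\<^sup>2)"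
    by (simp add: sum.cartesian_product)
  have DD: "(\<Sum>j<2 * N. \<Sum>k<2 * N. e ((real j - real k) * x)) = of_real ((cmod (D x))\<^sup>2)" for x
  proof -
    have "of_real ((cmod (D x))\<^sup>2) = D x * cnj (D x)" by (rule complex_norm_square)
    also have "\<dots> = (\<Sum>j<2 * N. \<Sum>k<2 * N. e (real j * x) * e (- (real k * x)))"
      by (simp add: D_def cnj_e sum_product)
    finally show ?thesis by (simp add: e_add[symmetric] left_diff_distrib)
  qed
  have "of_real (\<Sum>j<2 * N. \<Sum>k<2 * N. (cmod (G (real j - real k)))\<^sup>2) =
      (\<Sum>j<2 * N. \<Sum>k<2 * N. \<Sum>r\<in>R. \<Sum>s\<in>R. c r * cnj (c s) * e ((real j - real k) * (\<alpha> r - \<alpha> s)))"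
  proof -
    have "of_real ((cmod (G x))\<^sup>2) = (\<Sum>r\<in>R. \<Sum>s\<in>R. c r * cnj (c s) * e (x * (\<alpha> r - \<alpha> s)))" for x
    proof -
      have "of_real ((cmod (G x))\<^sup>2) = G x * cnj (G x)" by (rule complex_norm_square)
      also have "\<dots> = (\<Sum>r\<in>R. \<Sum>s\<in>R. (c r * e (x * \<alpha> r)) * (cnj (c s) * e (- (x * \<alpha> s))))"
        by (simp add: G_def cnj_e sum_product)
      also have "\<dots> = (\<Sum>r\<in>R. \<Sum>s\<in>R. c r * cnj (c s) * e (x * (\<alpha> r - \<alpha> s)))"
      proof (intro sum.cong refl)
        fix r s
        have "e (x * (\<alpha> r - \<alpha> s)) = e (x * \<alpha> r) * e (- (x * \<alpha> s))"
          by (simp add: right_diff_distrib flip: e_add)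
        thus "c r * e (x * \<alpha> r) * (cnj (c s) * e (- (x * \<alpha> s))) = c r * cnj (c s) * e (x * (\<alpha> r - \<alpha> s))"
          by simp
      qed
      finally show ?thesis .
    qed
    thus ?thesis by simp
  qed
  also have "\<dots> = (\<Sum>j<2 * N. \<Sum>r\<in>R. \<Sum>s\<in>R. \<Sum>k<2 * N. c r * cnj (c s) * e ((real j - real k) * (\<alpha> r - \<alpha> s)))"
    by (subst (2) sum.swap, subst (3) sum.swap) (rule refl)
  also have "\<dots> = (\<Sum>r\<in>R. \<Sum>s\<in>R. \<Sum>j<2 * N. \<Sum>k<2 * N. c r * cnj (c s) * e ((real j - real k) * (\<alpha> r - \<alpha> s)))"
    by (subst sum.swap, subst (2) sum.swap) (rule refl)
  also have "\<dots> = (\<Sum>r\<in>R. \<Sum>s\<in>R. c r * cnj (c s) * of_real ((cmod (D (\<alpha> r - \<alpha> s)))\<^sup>2))"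
    unfolding sum_distrib_left[symmetric] DD ..
  finally have expand: "complex_of_real (\<Sum>j<2 * N. \<Sum>k<2 * N. (cmod (G (real j - real k)))\<^sup>2) =
      (\<Sum>r\<in>R. \<Sum>s\<in>R. c r * cnj (c s) * of_real ((cmod (D (\<alpha> r - \<alpha> s)))\<^sup>2))" .
  have "(\<Sum>j<2 * N. \<Sum>k<2 * N. (cmod (G (real j - real k)))\<^sup>2) =
      cmod (complex_of_real (\<Sum>j<2 * N. \<Sum>k<2 * N. (cmod (G (real j - real k)))\<^sup>2))"
    unfolding norm_of_real by (rule abs_of_nonneg[symmetric]) (intro sum_nonneg zero_le_power2)
  also have "\<dots> = cmod (\<Sum>r\<in>R. \<Sum>s\<in>R. c r * cnj (c s) * of_real ((cmod (D (\<alpha> r - \<alpha> s)))\<^sup>2))"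
    by (simp only: expand)
  also have "\<dots> \<le> (\<Sum>r\<in>R. \<Sum>s\<in>R. cmod (c r) * cmod (c s) * (cmod (D (\<alpha> r - \<alpha> s)))\<^sup>2)"
    by (intro order_trans[OF norm_sum] sum_mono) (simp add: norm_mult norm_power)
  \<comment> \<open>Arithmetic-geometric mean; since \<open>|D|\<close> is even, the two halves
    coincide after exchanging \<open>r\<close> and \<open>s\<close>.\<close>
  also have "\<dots> \<le> (\<Sum>r\<in>R. \<Sum>s\<in>R. (cmod (c r))\<^sup>2 / 2 * (cmod (D (\<alpha> s - \<alpha> r)))\<^sup>2
      + (cmod (c s))\<^sup>2 / 2 * (cmod (D (\<alpha> r - \<alpha> s)))\<^sup>2)"
  proof (intro sum_mono)
    fix r s
    have "cmod (c r) * cmod (c s) \<le> (cmod (c r))\<^sup>2 / 2 + (cmod (c s))\<^sup>2 / 2"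
      using sum_squares_bound[of "cmod (c r)" "cmod (c s)"] by simp
    hence "cmod (c r) * cmod (c s) * (cmod (D (\<alpha> r - \<alpha> s)))\<^sup>2 \<le>
      ((cmod (c r))\<^sup>2 / 2 + (cmod (c s))\<^sup>2 / 2) * (cmod (D (\<alpha> r - \<alpha> s)))\<^sup>2"
      by (rule mult_right_mono) simp
    thus "cmod (c r) * cmod (c s) * (cmod (D (\<alpha> r - \<alpha> s)))\<^sup>2 \<le> 
      (cmod (c r))\<^sup>2 / 2 * (cmod (D (\<alpha> s - \<alpha> r)))\<^sup>2 + (cmod (c s))\<^sup>2 / 2 * (cmod (D (\<alpha> r - \<alpha> s)))\<^sup>2"
      using D_minus[of "\<alpha> r - \<alpha> s"] by (simp add: distrib_right)
  qed
  also have "\<dots> = (\<Sum>r\<in>R. (cmod (c r))\<^sup>2 / 2 * (\<Sum>s\<in>R. (cmod (D (\<alpha> s - \<alpha> r)))\<^sup>2))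
      + (\<Sum>s\<in>R. (cmod (c s))\<^sup>2 / 2 * (\<Sum>r\<in>R. (cmod (D (\<alpha> r - \<alpha> s)))\<^sup>2))"
    unfolding sum.distrib sum_distrib_left
    by (rule arg_cong2[where f = "(+)", OF refl]) (rule sum.swap)
  also have "\<dots> = (\<Sum>r\<in>R. (cmod (c r))\<^sup>2 * (\<Sum>s\<in>R. (cmod (D (\<alpha> s - \<alpha> r)))\<^sup>2))"
    by (simp flip: sum.distrib)
  also have "\<dots> \<le> (\<Sum>r\<in>R. (cmod (c r))\<^sup>2 * (9 * K * (real N)\<^sup>2))"
    unfolding D_def using assms
    by (intro sum_mono mult_left_mono sum_norm_geometric_sum_e_le) auto
  also have "\<dots> = N * (9 * K * N * (\<Sum>r\<in>R. (cmod (c r))\<^sup>2))"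
    unfolding sum_distrib_right[symmetric] by (simp add: power2_eq_square mult_ac)
  finally have "N * (\<Sum>n<N. (cmod (G n))\<^sup>2) \<le> N * (9 * K * N * (\<Sum>r\<in>R. (cmod (c r))\<^sup>2))"
    using 1 by linarith
  thus ?thesis using assms(2) by (simp add: G_def)
qed

text \<open>Duality: the left side \<open>T\<close> equals a pairing of \<open>a\<close> with the
  dual sums \<open>G\<close> for coefficients of norm \<open>|S|\<close>. Cauchy-Schwarz and the
  dual bound give \<open>T\<^sup>2 \<le> 9 * K * N * Z * T\<close>.\<close>

lemma large_sieve:
  fixes \<alpha> :: "'i \<Rightarrow> real" and K :: real and N :: nat
  assumes "finite R" "N \<ge> 1"
    and K: "\<And>\<beta>. real (card {s \<in> R. frac (\<alpha> s - \<beta>) < 1 / N}) \<le> K"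
  shows "(\<Sum>r\<in>R. (cmod (S a M N (\<alpha> r)))\<^sup>2) \<le> 9 * K * N * Z a M N"
proof -
  define f where "f i = M + 1 + int i" for i :: nat
  have f: "bij_betw f {..<N} {M + 1..M + int N}"
  proof (rule bij_betwI[where g = "\<lambda>n. nat (n - M - 1)"])
  qed (auto simp: f_def)
  have S_eq: "S a M N x = (\<Sum>i<N. a (f i) * e (of_int (f i) * x))" for x
    unfolding S_def by (rule sum.reindex_bij_betw[OF f, symmetric])
  have Z_eq: "Z a M N = (\<Sum>i<N. (cmod (a (f i)))\<^sup>2)"
    unfolding Z_def by (rule sum.reindex_bij_betw[OF f, symmetric])
  define T where "T = (\<Sum>r\<in>R. (cmod (S a M N (\<alpha> r)))\<^sup>2)"
  \<comment> \<open>The conjugate makes each summand \<open>|S|\<^sup>2\<close>; the twist moves the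
    range of \<open>n\<close> to start at 0.\<close>
  define c where "c r = cnj (S a M N (\<alpha> r)) * e (of_int (M + 1) * \<alpha> r)" for r
  have norm_c: "cmod (c r) = cmod (S a M N (\<alpha> r))" for r
    by (simp add: c_def norm_mult)
  define G where "G i = (\<Sum>r\<in>R. c r * e (real i * \<alpha> r))" for i :: nat
  have "complex_of_real T = (\<Sum>r\<in>R. cnj (S a M N (\<alpha> r)) * S a M N (\<alpha> r))"
    by (simp add: T_def complex_norm_square mult.commute del: of_real_power)
  also have "\<dots> = (\<Sum>r\<in>R. \<Sum>i<N. a (f i) * (c r * e (real i * \<alpha> r)))"
  proof (rule sum.cong[OF refl])
    fix r
    have "e (of_int (f i) * \<alpha> r) = e (of_int (M + 1) * \<alpha> r) * e (real i * \<alpha> r)" for i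
      by (simp add: f_def distrib_right flip: e_add)
    thus "cnj (S a M N (\<alpha> r)) * S a M N (\<alpha> r) = (\<Sum>i<N. a (f i) * (c r * e (real i * \<alpha> r)))"
      by (subst (2) S_eq) (simp add: sum_distrib_left c_def mult_ac)
  qed
  also have "\<dots> = (\<Sum>i<N. a (f i) * G i)"
    by (subst sum.swap) (simp add: G_def sum_distrib_left)
  finally have T_eq: "complex_of_real T = (\<Sum>i<N. a (f i) * G i)" .
  have T0: "T \<ge> 0" by (simp add: T_def sum_nonneg)
  have "T = cmod (\<Sum>i<N. a (f i) * G i)" using T0 by (simp flip: T_eq)
  also have "\<dots> \<le> (\<Sum>i<N. cmod (a (f i)) * cmod (G i))"
    by (rule order_trans[OF norm_sum]) (simp add: norm_mult)
  finally have "T\<^sup>2 \<le> (\<Sum>i<N. cmod (a (f i)) * cmod (G i))\<^sup>2"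
    using T0 by (intro power_mono)
  also have "\<dots> \<le> Z a M N * (\<Sum>i<N. (cmod (G i))\<^sup>2)"
    unfolding Z_eq by (rule Cauchy_Schwarz_ineq_sum)
  also have "\<dots> \<le> Z a M N * (9 * K * N * T)"
  proof (rule mult_left_mono)
    show "(\<Sum>i<N. (cmod (G i))\<^sup>2) \<le> 9 * K * N * T"
      using dual_large_sieve[OF assms, of c] unfolding G_def T_def norm_c .
    show "0 \<le> Z a M N" by (simp add: Z_def sum_nonneg)
  qed
  finally have TT: "T * T \<le> (9 * K * N * Z a M N) * T" by (simp add: power2_eq_square mult_ac)
  have "T \<le> 9 * K * N * Z a M N"
  proof (cases "T = 0")
    case True
    have "K \<ge> 0" using K[of 0] by (meson of_nat_0_le_iff order_trans)
    thus ?thesis using True by (simp add: Z_def sum_nonneg)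
  next
    case False
    thus ?thesis using TT T0 by simp
  qed
  thus ?thesis by (simp add: T_def)
qed

section \<open>From counting modulo 1 to the final estimate\<close>

lemma card_fractions_square_denominator_frac_le:
  fixes Q \<beta> :: real and N :: nat
  assumes "N \<ge> 1" "Q \<ge> 1"
    and R: "R \<subseteq> (SIGMA q:{q::nat. 1 \<le> q \<and> real q \<le> Q}. {b. 1 \<le> b \<and> b \<le> q\<^sup>2 \<and> gcd b q = 1})"
    and "finite R"
    and near: "\<And>q b. (q, b) \<in> R \<Longrightarrow> frac (real b / (real q)\<^sup>2 - \<beta>) < 1 / N"
  obtains r :: nat where "0 < r" "r \<le> N"
    "real (card R) \<le> 1 + (24 * Q\<^sup>2 / sqrt N + 48 * Q ^ 3 / N) * card {d. d dvd r}"
proof -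
  \<comment> \<open>Subtracting the integer part \<open>k\<close> from the fraction replaces
    \<open>b\<close> by \<open>b - k * q\<^sup>2\<close>. This keeps it coprime to \<open>q\<close>
    and places the fraction in \<open>[\<beta>, \<beta> + 1 / N)\<close> on the real line.\<close>
  define k where "k q b = \<lfloor>real b / (real q)\<^sup>2 - \<beta>\<rfloor>" for q b :: nat
  define f where "f = (\<lambda>(q, b). (int q, int b - k q b * (int q)\<^sup>2))"
  have "inj_on f R"
  proof (rule inj_onI)
    fix s s' assume s: "s \<in> R" "s' \<in> R" "f s = f s'"
    obtain q b q' b' where qb: "s = (q, b)" "s' = (q', b')" by (metis surj_pair)
    have "q = q'" using s(3) by (simp add: f_def qb)
    have b: "1 \<le> b" "b \<le> q\<^sup>2" "1 \<le> b'" "b' \<le> q\<^sup>2" using s R by (auto simp: qb \<open>q = q'\<close>)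
    have "int b - int b' = (k q b - k q b') * (int q)\<^sup>2"
      using s(3) by (simp add: f_def qb \<open>q = q'\<close> algebra_simps)
    hence "(int q)\<^sup>2 dvd int b - int b'" by simp
    \<comment> \<open>Numerators from 1 to \<open>q\<^sup>2\<close> represent each residue class
      once, so the shift merges no two fractions.\<close>
    moreover have "\<bar>int b - int b'\<bar> < (int q)\<^sup>2"
      using b by (simp flip: of_nat_power)
    ultimately have "int b - int b' = 0"
      using dvd_imp_le_int[of "int b - int b'" "(int q)\<^sup>2"] by fastforce
    thus "s = s'" by (simp add: qb \<open>q = q'\<close>)
  qed
  hence card: "card (f ` R) = card R" by (rule card_image)
  show thesis
  proof (rule card_fractions_square_denominator_near_le[OF assms(1,2), of "f ` R" \<beta>])
    show "finite (f ` R)" using assms(4) by simp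
  next
    fix q a assume "(q, a) \<in> f ` R"
    then obtain p b where pb: "(p, b) \<in> R" "q = int p" "a = int b - k p b * (int p)\<^sup>2"
      by (auto simp: f_def)
    have p: "1 \<le> p" "real p \<le> Q" "gcd b p = 1" using pb(1) R by auto
    have "gcd a q = gcd (int b) (int p)"
      using gcd_add_mult[of "int p" "- k p b * int p" "int b"]
      by (simp add: pb power2_eq_square gcd.commute algebra_simps)
    hence "coprime a q" using p(3) by (simp add: coprime_iff_gcd_eq_1 gcd_int_int_eq)
    moreover have "real_of_int a / (real_of_int q)\<^sup>2 - \<beta> = frac (real b / (real p)\<^sup>2 - \<beta>)"
      using p(1) by (simp add: pb frac_def k_def field_simps)
    ultimately show "1 \<le> q \<and> real_of_int q \<le> Q \<and> coprime a q \<and>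
        \<bar>real_of_int a / (real_of_int q)\<^sup>2 - \<beta>\<bar> \<le> 1 / N"
      using near[OF pb(1)] p by (simp add: pb(2))
  qed (use that card in simp)
qed

theorem mainTheorem1:
  fixes \<epsilon> :: real
  assumes "\<epsilon> > 0"
  shows "\<exists>C::real. C > 0 \<and>
    (\<forall>(M::int) (N::nat) (Q::real) (a::int \<Rightarrow> complex). N \<ge> 1 \<longrightarrow> Q \<ge> 1 \<longrightarrow>
      (\<Sum>q \<in> {q::nat. 1 \<le> q \<and> real q \<le> Q}.
         \<Sum>b \<in> {b::nat. 1 \<le> b \<and> b \<le> q\<^sup>2 \<and> gcd b q = 1}.
           (cmod (S a M N (real b / (real q)\<^sup>2)))\<^sup>2)
      \<le> C * (real N * Q) powr \<epsilon> * (Q ^ 3 + real N + sqrt (real N) * Q\<^sup>2) * Z a M N)"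
proof -
  obtain C where C: "C \<ge> 1" "\<And>n. n > 0 \<Longrightarrow> real (card {d::nat. d dvd n}) \<le> C * real n powr \<epsilon>"
    using divisor_bound[OF assms] by blast
  show ?thesis
  proof (intro exI[of _ "432 * C"] conjI allI impI)
    show "432 * C > 0" using C(1) by simp
    fix M :: int and N :: nat and Q :: real and a :: "int \<Rightarrow> complex"
    assume N: "N \<ge> 1" and Q: "Q \<ge> 1"
    define A where "A = {q::nat. 1 \<le> q \<and> real q \<le> Q}"
    define B where "B q = {b::nat. 1 \<le> b \<and> b \<le> q\<^sup>2 \<and> gcd b q = 1}" for q
    have finA: "finite A"
      by (rule finite_subset[of _ "{..nat \<lfloor>Q\<rfloor>}"]) (auto simp: A_def le_nat_floor)
    have finB: "finite (B q)" for q
      by (rule finite_subset[of _ "{..q\<^sup>2}"]) (auto simp: B_def)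
    have fin: "finite (Sigma A B)" using finA finB by simp
    \<comment> \<open>\<open>W\<close> bounds the divisor function for all \<open>r \<le> N\<close>
      at once. As \<open>W \<ge> 1\<close>, the lone summand 1 of the count is absorbed into
      \<open>48 * W\<close>.\<close>
    define W where "W = C * (N * Q) powr \<epsilon>"
    define K where "K = 48 * W * (1 + Q\<^sup>2 / sqrt N + Q ^ 3 / N)"
    have NQ: "N \<le> N * Q" using N Q by simp
    have W: "card {d. d dvd r} \<le> W" if "0 < r" "r \<le> N" for r
    proof -
      have "real r powr \<epsilon> \<le> (N * Q) powr \<epsilon>"
        using that NQ assms by (intro powr_mono2) linarith+
      hence "C * real r powr \<epsilon> \<le> W" using C(1) unfolding W_def by (intro mult_left_mono) auto
      thus ?thesis using C(2)[OF that(1)] by linarith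
    qed
    have W1: "W \<ge> 1" using W[of 1] N by simp
    have K: "real (card {s \<in> Sigma A B. frac ((case s of (q, b) \<Rightarrow> real b / (real q)\<^sup>2) - \<beta>) < 1 / N}) \<le> K"
      (is "real (card ?U) \<le> K") for \<beta>
    proof -
      obtain r where r: "0 < r" "r \<le> N"
        "real (card ?U) \<le> 1 + (24 * Q\<^sup>2 / sqrt N + 48 * Q ^ 3 / N) * card {d. d dvd r}"
      proof (rule card_fractions_square_denominator_frac_le[OF N Q, of ?U \<beta>])
        show "?U \<subseteq> (SIGMA q:{q. 1 \<le> q \<and> real q \<le> Q}. {b. 1 \<le> b \<and> b \<le> q\<^sup>2 \<and> gcd b q = 1})"
          by (auto simp: A_def B_def)
      qed (use fin in auto)
      note r(3)
      also have "1 + (24 * Q\<^sup>2 / sqrt N + 48 * Q ^ 3 / N) * card {d. d dvd r} \<le>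
          48 * W + (48 * Q\<^sup>2 / sqrt N + 48 * Q ^ 3 / N) * W"
        using W[OF r(1,2)] W1 Q
        by (intro add_mono mult_mono divide_right_mono mult_right_mono) auto
      also have "\<dots> = K" by (simp add: K_def algebra_simps)
      finally show ?thesis .
    qed
    have "(\<Sum>q\<in>A. \<Sum>b\<in>B q. (cmod (S a M N (real b / (real q)\<^sup>2)))\<^sup>2) =
        (\<Sum>s\<in>Sigma A B. (cmod (S a M N (case s of (q, b) \<Rightarrow> real b / (real q)\<^sup>2)))\<^sup>2)"
      using finA finB by (subst sum.Sigma) (auto intro!: sum.cong)
    also have "\<dots> \<le> 9 * K * N * Z a M N"
      by (rule large_sieve[OF fin N K])
    \<comment> \<open>\<open>432 = 9 * 48\<close>; multiplying \<open>K\<close> by \<open>N\<close>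
      turns its three terms into \<open>N\<close>, \<open>sqrt N * Q\<^sup>2\<close> and
      \<open>Q ^ 3\<close>.\<close>
    also have "9 * K * N = 432 * W * (Q ^ 3 + N + (N / sqrt N) * Q\<^sup>2)"
      using N by (simp add: K_def field_simps)
    also have "N / sqrt N = sqrt N" by (rule real_div_sqrt) simp
    finally show "(\<Sum>q \<in> {q::nat. 1 \<le> q \<and> real q \<le> Q}.
         \<Sum>b \<in> {b::nat. 1 \<le> b \<and> b \<le> q\<^sup>2 \<and> gcd b q = 1}.
           (cmod (S a M N (real b / (real q)\<^sup>2)))\<^sup>2)
      \<le> 432 * C * (real N * Q) powr \<epsilon> * (Q ^ 3 + real N + sqrt (real N) * Q\<^sup>2) * Z a M N"
      by (simp add: A_def B_def W_def mult.assoc)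
  qed
qed

end
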